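(* Let $\{z_t\},\{y_t\},\{x_t\}$ be generated by the AC-FGM algorithm (see context) applied to $\min_{x\in X}\{\Psi(x)=f(x)+h(x)\}$ with $f$ smooth, with initial point $x_0=y_0=z_0\in X$ and parameters $\eta_t>0$, $\tau_t\ge 0$, $\beta_t$. Assume that $x_1\neq x_0$ and that for some $\beta\in(0,1)$ $$\tau_1=0,\qquad \beta_1=0,\qquad \beta_t=\beta\ \ (t\ge 2),$$ $$\eta_2\le\min\Big\{(1-\beta)\eta_1,\ \tfrac{1}{4L_1}\Big\},$$ $$\eta_t\le\min\Big\{2(1-\beta)^2\eta_{t-1},\ \tfrac{\tau_{t-1}}{4L_{t-1}},\ \tfrac{\tau_{t-2}+1}{\tau_{t-1}}\,\eta_{t-1}\Big\}\quad\text{for all } t\ge 3,$$ where the $L_t$ are the local estimates defined in the context. Then the sequences $\{z_t\}$, $\{y_t\}$, $\{x_t\}$ are bounded. Moreover, for every $x^*\in X^*$ and every $k\ge1$, $$\Psi(x_k)-\Psi(x^* )\le\frac{1}{(\tau_k+1)\eta_{k+1}}\Big[\tfrac{1}{2\beta}\|z_0-x^*\|^2+\Big(\tfrac{5\eta_2L_1}{4}-\tfrac{\eta_2}{2\eta_1}\Big)\|z_1-z_0\|^2\Big]$$ and $$\Psi(\bar x_k)-\Psi(x^* )\le\frac{1}{\sum_{t=2}^{k+1}\eta_t}\Big[\tfrac{1}{2\beta}\|z_0-x^*\|^2+\Big(\tfrac{5\eta_2L_1}{4}-\tfrac{\eta_2}{2\eta_1}\Big)\|z_1-z_0\|^2\Big],$$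 where $$\bar x_k:=\frac{\sum_{t=1}^{k-1}\big[(\tau_t+1)\eta_{t+1}-\tau_{t+1}\eta_{t+2}\big]x_t+(\tau_k+1)\eta_{k+1}x_k}{\sum_{t=2}^{k+1}\eta_t}.$$
   Context: Problem: $X\subseteq\mathbb{R}^n$ is a nonempty closed convex set, $h:X\to\mathbb{R}$ and $f:X\to\mathbb{R}$ are closed convex functions, $\Psi:=f+h$, and the set $X^*$ of minimizers of $\Psi$ over $X$ is nonempty. $\langle\cdot,\cdot\rangle$ is the Euclidean inner product and $\|\cdot\|$ the Euclidean norm. For $x\in X$, $g(x)\in\partial f(x)$ denotes the (sub)gradient returned by the first-order oracle. $f$ is smooth: there is $L>0$ (unknown to the algorithm) such that for all $x,y\in X$, $\|g(x)-g(y)\|\le L\|x-y\|$ and $$\tfrac{1}{2L}\|g(y)-g(x)\|^2\le f(y)-f(x)-\langle g(x),y-x\rangle\le\tfrac L2\|y-x\|^2 .$$ AC-FGM algorithm: starting from $z_0=y_0=x_0\in X$, for $t=1,2,\dots$ $$z_t=\arg\min_{z\in X}\big\{\eta_t[\langle g(x_{t-1}),z\rangle+h(z)]+\tfrac12\|y_{t-1}-z\|^2\big\},$$ $$y_t=(1-\beta_t)y_{t-1}+\beta_tz_t,\qquad x_t=\frac{z_t+\tau_tx_{t-1}}{1+\tau_t}.$$ The parameters may depend on previously generated iterates. Local estimates: $L_1:=\|g(x_1)-g(x_0)\|/\|x_1-x_0\|$ (with $\eta_1$ chosen such that $x_1\ne x_0$). For $t\ge2$, with $B_t:=f(x_{t-1})-f(x_t)-\langle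 g(x_t),x_{t-1}-x_t\rangle\ (\ge 0)$, set $L_t:=0$ if $B_t=0$ and $L_t:=\|g(x_t)-g(x_{t-1})\|^2/(2B_t)$ if $B_t>0$. Conventions: $\tfrac00=0$ and $\tfrac a0=+\infty$ for $a>0$. *)

theory Defs
  imports "HOL-Analysis.Analysis"
begin

text \<open>
  Functions on \<open>X\<close> are modelled by total functions whose values outside \<open>X\<close> are irrelevant;
  all notions below only refer to values on \<open>X\<close>.
\<close>

definition closed_convex_fun :: "(real ^ 'n) set \<Rightarrow> (real ^ 'n \<Rightarrow> real) \<Rightarrow> bool" where
  "closed_convex_fun X f \<longleftrightarrow> convex_on X f \<and> closed (epigraph X f)"

definition subdifferential ::
    "(real ^ 'n) set \<Rightarrow> (real ^ 'n \<Rightarrow> real) \<Rightarrow> real ^ 'n \<Rightarrow> (real ^ 'n) set" where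
  "subdifferential X f x = {v. \<forall>y\<in>X. f y \<ge> f x + v \<bullet> (y - x)}"

definition smooth_oracle ::
    "(real ^ 'n) set \<Rightarrow> (real ^ 'n \<Rightarrow> real) \<Rightarrow> (real ^ 'n \<Rightarrow> real ^ 'n) \<Rightarrow> bool" where
  "smooth_oracle X f g \<longleftrightarrow>
     (\<forall>x\<in>X. g x \<in> subdifferential X f x) \<and>
     (\<exists>L>0. \<forall>x\<in>X. \<forall>y\<in>X.
        norm (g x - g y) \<le> L * norm (x - y) \<and>
        1 / (2 * L) * (norm (g y - g x))\<^sup>2 \<le> f y - f x - g x \<bullet> (y - x) \<and>
        f y - f x - g x \<bullet> (y - x) \<le> L / 2 * (norm (y - x))\<^sup>2)"

definition minimizers :: "(real ^ 'n) set \<Rightarrow> (real ^ 'n \<Rightarrow> real) \<Rightarrow> (real ^ 'n) set" where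
  "minimizers X F = {x. is_arg_min F (\<lambda>u. u \<in> X) x}"

text \<open>
  The parameter sequences are arbitrary, so they may in particular be chosen adaptively
  from the iterates. Their values at index \<open>0\<close> are unused.
\<close>

definition ac_fgm ::
    "(real ^ 'n) set \<Rightarrow> (real ^ 'n \<Rightarrow> real) \<Rightarrow> (real ^ 'n \<Rightarrow> real ^ 'n) \<Rightarrow>
     (nat \<Rightarrow> real) \<Rightarrow> (nat \<Rightarrow> real) \<Rightarrow> (nat \<Rightarrow> real) \<Rightarrow>
     (nat \<Rightarrow> real ^ 'n) \<Rightarrow> (nat \<Rightarrow> real ^ 'n) \<Rightarrow> (nat \<Rightarrow> real ^ 'n) \<Rightarrow> bool" where
  "ac_fgm X h g \<eta> \<tau> \<beta> z y x \<longleftrightarrow>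
     x 0 \<in> X \<and> y 0 = x 0 \<and> z 0 = x 0 \<and>
     (\<forall>t\<ge>1.
        is_arg_min (\<lambda>u. \<eta> t * (g (x (t - 1)) \<bullet> u + h u) + 1 / 2 * (norm (y (t - 1) - u))\<^sup>2)
          (\<lambda>u. u \<in> X) (z t) \<and>
        y t = (1 - \<beta> t) *\<^sub>R y (t - 1) + \<beta> t *\<^sub>R z t \<and>
        x t = (z t + \<tau> t *\<^sub>R x (t - 1)) /\<^sub>R (1 + \<tau> t))"

text \<open>Only meant for \<open>t \<ge> 1\<close>.\<close>

definition local_estimate ::
    "(real ^ 'n \<Rightarrow> real) \<Rightarrow> (real ^ 'n \<Rightarrow> real ^ 'n) \<Rightarrow> (nat \<Rightarrow> real ^ 'n) \<Rightarrow> nat \<Rightarrow> real" where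
  "local_estimate f g x t =
     (if t = 1 then norm (g (x 1) - g (x 0)) / norm (x 1 - x 0)
      else let B = f (x (t - 1)) - f (x t) - g (x t) \<bullet> (x (t - 1) - x t)
           in if B = 0 then 0 else (norm (g (x t) - g (x (t - 1))))\<^sup>2 / (2 * B))"

definition averaged_iterate ::
    "(nat \<Rightarrow> real) \<Rightarrow> (nat \<Rightarrow> real) \<Rightarrow> (nat \<Rightarrow> real ^ 'n) \<Rightarrow> nat \<Rightarrow> real ^ 'n" where
  "averaged_iterate \<eta> \<tau> x k =
     ((\<Sum>t = 1..k - 1. ((\<tau> t + 1) * \<eta> (t + 1) - \<tau> (t + 1) * \<eta> (t + 2)) *\<^sub>R x t)
        + ((\<tau> k + 1) * \<eta> (k + 1)) *\<^sub>R x k) /\<^sub>R (\<Sum>t = 2..k + 1. \<eta> t)"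

text \<open>
  The step size bounds are stated in \<^typ>\<open>ereal\<close>, since a denominator may vanish and
  division there satisfies exactly the conventions \<open>0 / 0 = 0\<close> and \<open>a / 0 = \<infinity>\<close> for \<open>a > 0\<close>
  (division on \<^typ>\<open>real\<close> would give \<open>a / 0 = 0\<close>).
\<close>

lemma ereal_zero_divide_zero: "ereal 0 / ereal 0 = 0"
  by (simp flip: zero_ereal_def)

lemma ereal_pos_divide_zero: "a > 0 \<Longrightarrow> ereal a / ereal 0 = \<infinity>"
  by (simp add: divide_ereal_def)

end

theory Submission
  imports Defs
begin

text \<open>
  Add the optimality condition of \<open>z (t + 1)\<close>, tested at \<open>u\<close>, to that of \<open>z t\<close>, tested at
  \<open>z (t + 1)\<close>. With the convexity of \<open>h\<close> and the subgradient inequality at \<open>x t\<close> this bounds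
  \<open>\<eta> (t + 1) * ((1 + \<tau> t) * \<Psi> (x t) - \<tau> t * \<Psi> (x (t - 1)) - \<Psi> u)\<close> by the decrease of
  \<open>\<parallel>y t - u\<parallel>\<^sup>2 / (2 * b)\<close> minus a remainder. By the step size rule the remainder is at least the
  increase of the potential \<open>(1 - b)\<^sup>2 / 4 * \<parallel>z t - y (t - 1)\<parallel>\<^sup>2\<close>, so everything telescopes;
  boundedness of \<open>y\<close> comes from the term \<open>\<parallel>y (k + 1) - u\<parallel>\<^sup>2 / (2 * b)\<close> left over at the end.
\<close>

section \<open>Variational inequality of a proximal step and the estimate of one iteration\<close>

lemma le_of_le_add_small:
  fixes a b c :: real
  assumes "\<And>l. 0 < l \<Longrightarrow> l \<le> 1 \<Longrightarrow> a \<le> b + l * c"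
  shows "a \<le> b"
proof -
  have "((\<lambda>l. b + l * c) \<longlongrightarrow> b + 0 * c) (at_right 0)"
    by (intro tendsto_intros)
  moreover have "eventually (\<lambda>l. a \<le> b + l * c) (at_right 0)"
    unfolding eventually_at_right_field using assms by (intro exI[of _ 1]) auto
  ultimately show ?thesis
    using tendsto_lowerbound[of "\<lambda>l. b + l * c" "b + 0 * c" "at_right (0::real)" a] by simp
qed

text \<open>Compare \<open>z\<close> with the point at fraction \<open>l\<close> of the segment from
  \<open>z\<close> to \<open>u\<close>. After convexity of \<open>h\<close> and expansion of the
  square every term carries a factor \<open>l\<close>; dividing by it leaves an error of order
  \<open>l\<close>, which vanishes in the limit.\<close>

lemma prox_step_inequality:
  fixes y v z u :: "'a::real_inner" and h :: "'a \<Rightarrow> real"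
  assumes h: "convex_on X h"
    and z: "is_arg_min (\<lambda>u. e * (v \<bullet> u + h u) + 1 / 2 * (norm (y - u))\<^sup>2) (\<lambda>u. u \<in> X) z"
    and e: "0 \<le> e" and u: "u \<in> X"
  shows "(y - z) \<bullet> (u - z) \<le> e * (v \<bullet> (u - z) + h u - h z)"
proof (rule le_of_le_add_small)
  fix l :: real assume l: "0 < l" "l \<le> 1"
  define p where "p = z + l *\<^sub>R (u - z)"
  have zX: "z \<in> X" using z by (simp add: is_arg_min_def)
  have p_eq: "p = (1 - l) *\<^sub>R z + l *\<^sub>R u" by (simp add: p_def algebra_simps)
  have pX: "p \<in> X"
    unfolding p_eq using convex_on_imp_convex[OF h] zX u l by (intro convexD) auto
  have hp: "h p \<le> (1 - l) * h z + l * h u"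
    unfolding p_eq using convex_onD[OF h, of l z u] l zX u by auto
  have "e * (v \<bullet> z + h z) + 1 / 2 * (norm (y - z))\<^sup>2 \<le> e * (v \<bullet> p + h p) + 1 / 2 * (norm (y - p))\<^sup>2"
    using z pX by (auto simp: is_arg_min_def not_less)
  moreover have "(norm (y - p))\<^sup>2 =
      (norm (y - z))\<^sup>2 - 2 * l * ((y - z) \<bullet> (u - z)) + l\<^sup>2 * (norm (u - z))\<^sup>2"
    unfolding p_def power2_norm_eq_inner
    by (simp add: inner_diff_left inner_diff_right inner_add_left inner_add_right inner_commute
        power2_eq_square algebra_simps)
  moreover have "e * (v \<bullet> p + h p) \<le> e * (v \<bullet> p + ((1 - l) * h z + l * h u))"
    using hp e by (intro mult_left_mono) auto
  moreover have "v \<bullet> p = v \<bullet> z + l * (v \<bullet> (u - z))"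
    by (simp add: p_def inner_add_right)
  ultimately have "l * ((y - z) \<bullet> (u - z))
      \<le> l * (e * (v \<bullet> (u - z) + h u - h z) + l * ((norm (u - z))\<^sup>2 / 2))"
    by (simp add: power2_eq_square algebra_simps)
  then show "(y - z) \<bullet> (u - z)
      \<le> e * (v \<bullet> (u - z) + h u - h z) + l * ((norm (u - z))\<^sup>2 / 2)"
    using l(1) by simp
qed

text \<open>Serves to trade the distance of \<open>z2\<close> to \<open>u\<close> for the distances
  of \<open>y1\<close> and \<open>y2\<close>, which telescope.\<close>

lemma norm_affine_combination_sq:
  fixes y z u :: "'a::real_inner"
  shows "(norm ((1 - b) *\<^sub>R y + b *\<^sub>R z - u))\<^sup>2 =
    (1 - b) * (norm (y - u))\<^sup>2 + b * (norm (z - u))\<^sup>2 - b * (1 - b) * (norm (z - y))\<^sup>2"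
  unfolding power2_norm_eq_inner
  by (simp add: inner_diff_left inner_diff_right inner_add_left inner_add_right inner_commute
      algebra_simps)

lemma inner_three_points:
  fixes y z u :: "'a::real_inner"
  shows "(y - z) \<bullet> (u - z) = ((norm (z - y))\<^sup>2 + (norm (u - z))\<^sup>2 - (norm (u - y))\<^sup>2) / 2"
  unfolding power2_norm_eq_inner
  by (simp add: inner_diff_left inner_diff_right inner_commute algebra_simps)

text \<open>Here \<open>x0\<close>, \<open>y0\<close> carry index \<open>t - 1\<close>, then \<open>z1\<close>, \<open>x1\<close>, \<open>y1\<close> index \<open>t\<close>, and \<open>z2\<close>, \<open>y2\<close>
  index \<open>t + 1\<close>.\<close>

lemma ac_fgm_step:
  fixes x0 x1 y0 y1 y2 z1 z2 u :: "real ^ 'n"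
  assumes h: "convex_on X h"
    and sub: "v1 \<in> subdifferential X f x1"
    and z1: "is_arg_min (\<lambda>u. e1 * (v0 \<bullet> u + h u) + 1 / 2 * (norm (y0 - u))\<^sup>2) (\<lambda>u. u \<in> X) z1"
    and z2: "is_arg_min (\<lambda>u. e2 * (v1 \<bullet> u + h u) + 1 / 2 * (norm (y1 - u))\<^sup>2) (\<lambda>u. u \<in> X) z2"
    and x1: "x1 = (z1 + T *\<^sub>R x0) /\<^sub>R (1 + T)"
    and y2: "y2 = (1 - b) *\<^sub>R y1 + b *\<^sub>R z2"
    and pos: "0 < e1" "0 < e2" "0 \<le> T" "0 < b"
    and X: "x0 \<in> X" "u \<in> X"
  shows "e2 * ((1 + T) * (f x1 + h x1) - T * (f x0 + h x0) - (f u + h u))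
      + e2 * (T * (f x0 - f x1 - v1 \<bullet> (x0 - x1)) + (v1 - v0) \<bullet> (z2 - z1))
      + e2 / e1 * ((y0 - z1) \<bullet> (z2 - z1)) + (1 - b / 2) * (norm (z2 - y1))\<^sup>2
    \<le> 1 / (2 * b) * ((norm (y1 - u))\<^sup>2 - (norm (y2 - u))\<^sup>2)"
proof -
  have zX: "z1 \<in> X" "z2 \<in> X" using z1 z2 by (auto simp: is_arg_min_def)
  have "(y1 - z2) \<bullet> (u - z2) \<le> e2 * (v1 \<bullet> (u - z2) + h u - h z2)"
    using prox_step_inequality[OF h z2 _ X(2)] pos by simp
  then have opt2: "((norm (z2 - y1))\<^sup>2 + (norm (z2 - u))\<^sup>2 - (norm (y1 - u))\<^sup>2) / 2
      \<le> e2 * (v1 \<bullet> (u - z2) + h u - h z2)"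
    unfolding inner_three_points by (simp add: norm_minus_commute)
  \<comment> \<open>The \<open>(1 - b) / 2\<close> produced here and the \<open>1 / 2\<close> in
    \<open>opt2\<close> add up to the coefficient \<open>1 - b / 2\<close> of the claim.\<close>
  have dist_y2: "(norm (z2 - u))\<^sup>2 / 2 - (norm (y1 - u))\<^sup>2 / 2 =
      1 / (2 * b) * ((norm (y2 - u))\<^sup>2 - (norm (y1 - u))\<^sup>2) + (1 - b) / 2 * (norm (z2 - y1))\<^sup>2"
    unfolding y2 norm_affine_combination_sq using pos by (simp add: field_simps)
  \<comment> \<open>The optimality condition of \<open>z1\<close> is rescaled so that its right-hand
    side carries \<open>e2\<close>, as in \<open>opt2\<close>.\<close>
  have "e2 / e1 * ((y0 - z1) \<bullet> (z2 - z1)) \<le> e2 / e1 * (e1 * (v0 \<bullet> (z2 - z1) + h z2 - h z1))"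
    using prox_step_inequality[OF h z1 _ zX(2)] pos by (intro mult_left_mono) auto
  then have opt1: "e2 / e1 * ((y0 - z1) \<bullet> (z2 - z1)) \<le> e2 * (v0 \<bullet> (z2 - z1) + h z2 - h z1)"
    using pos by simp
  have x1_scaled: "(1 + T) *\<^sub>R x1 = z1 + T *\<^sub>R x0" using x1 pos by simp
  then have z1_eq: "z1 = x1 + T *\<^sub>R (x1 - x0)" by (simp add: algebra_simps)
  have sub_ineq: "f x1 + v1 \<bullet> (u - x1) \<le> f u"
    using sub X by (auto simp: subdifferential_def)
  define r where "r = inverse (1 + T)"
  have r: "1 - r * T = r" "0 \<le> r * T" "r * T \<le> 1" "(1 + T) * r = 1"
    using pos by (auto simp: r_def field_simps)
  have "x1 = (1 - r * T) *\<^sub>R z1 + (r * T) *\<^sub>R x0"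
    unfolding r(1) using x1 by (simp add: r_def scaleR_add_right)
  then have "h x1 \<le> (1 - r * T) * h z1 + (r * T) * h x0"
    using convex_onD[OF h r(2,3), of z1 x0] zX X by simp
  then have "h x1 \<le> r * (h z1 + T * h x0)"
    unfolding r(1) by (simp add: algebra_simps)
  then have "(1 + T) * h x1 \<le> (1 + T) * (r * (h z1 + T * h x0))"
    using pos by (intro mult_left_mono) auto
  then have h_ineq: "(1 + T) * h x1 \<le> h z1 + T * h x0"
    using r(4) by (simp add: mult.assoc[symmetric])
  \<comment> \<open>On the left all inner products with \<open>z2 - z1\<close> combine to
    \<open>v1 \<bullet> (z2 - z1)\<close>, and the values \<open>f x0\<close> cancel. What remains
    of \<open>v1 \<bullet> (z1 - u)\<close> splits by \<open>z1_eq\<close> into the extrapolation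
    part, present on the left, and \<open>v1 \<bullet> (x1 - u)\<close>, handled by
    \<open>sub_ineq\<close>.\<close>
  have "(1 + T) * (f x1 + h x1) - T * (f x0 + h x0) - (f u + h u)
      + T * (f x0 - f x1 - v1 \<bullet> (x0 - x1)) + (v1 - v0) \<bullet> (z2 - z1) + v0 \<bullet> (z2 - z1) + h z2 - h z1
    \<le> v1 \<bullet> (z2 - u) + h z2 - h u"
    using sub_ineq h_ineq unfolding z1_eq
    by (simp add: inner_diff_left inner_diff_right inner_add_right algebra_simps)
  then have "e2 * ((1 + T) * (f x1 + h x1) - T * (f x0 + h x0) - (f u + h u)
      + T * (f x0 - f x1 - v1 \<bullet> (x0 - x1)) + (v1 - v0) \<bullet> (z2 - z1) + v0 \<bullet> (z2 - z1) + h z2 - h z1)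
    \<le> e2 * (v1 \<bullet> (z2 - u) + h z2 - h u)"
    using pos by (intro mult_left_mono) auto
  then show ?thesis
    using opt1 opt2 dist_y2
    by (simp add: inner_diff_right algebra_simps add_divide_distrib diff_divide_distrib)
qed

section \<open>Lower bounds for the remainder of one iteration\<close>

lemma norm_diff_sq_le:
  fixes p q r :: "'a::real_inner"
  shows "(norm (p - q))\<^sup>2 \<le> 2 * (norm (p - r))\<^sup>2 + 2 * (norm (q - r))\<^sup>2"
proof -
  have "0 \<le> (norm ((p - r) + (q - r)))\<^sup>2" by simp
  then show ?thesis
    unfolding power2_norm_eq_inner
    by (simp add: inner_diff_left inner_diff_right inner_add_left inner_add_right inner_commute
        algebra_simps)
qed

text \<open>Scalar core of the potential argument, with \<open>u = 1 - b\<close>; \<open>a\<close>,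
  \<open>a'\<close> are the squared norms of \<open>z1 - y0\<close> and \<open>z2 - y1\<close>, and
  \<open>d\<close> that of \<open>z2 - z1\<close>. The loss \<open>d / 8\<close> is reserved for the
  gradient term.\<close>

lemma potential_increase_scalar:
  fixes a a' d c u :: real
  assumes nn: "0 \<le> a" "0 \<le> a'" "0 \<le> d" and u: "0 < u" "u < 1" and c: "0 \<le> c" "c \<le> 2 * u"
    and d: "d \<le> 2 * a' + 2 * (u\<^sup>2 * a)" and a': "a' \<le> 2 * d + 2 * (u\<^sup>2 * a)"
  shows "u\<^sup>2 / 4 * (a' - a) \<le> c / 2 * (u\<^sup>2 * a + d - a') + (1 + u) / 2 * a' - d / 8"
proof -
  define s where "s = c / (2 * u)"
  have s: "0 \<le> s" "s \<le> 1" "c = s * (2 * u)" using c u by (auto simp: s_def)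
  have usq: "0 \<le> u\<^sup>2" "u\<^sup>2 \<le> 1" using u by (auto simp: power_le_one)
  define F where "F c = c / 2 * (u\<^sup>2 * a + d - a') + (1 + u) / 2 * a' - d / 8 - u\<^sup>2 / 4 * (a' - a)" for c
  have F0: "0 \<le> F 0"
  proof -
    have "0 \<le> (1 + u) / 2 - 1 / 4 - u\<^sup>2 / 4" using usq u by (simp add: field_simps)
    then have "0 \<le> ((1 + u) / 2 - 1 / 4 - u\<^sup>2 / 4) * a'" using nn(2) by (rule mult_nonneg_nonneg)
    moreover have "F 0 = ((1 + u) / 2 - 1 / 4 - u\<^sup>2 / 4) * a'
        + (2 * a' + 2 * (u\<^sup>2 * a) - d) / 8"
      unfolding F_def by argo
    ultimately show ?thesis using d by simp
  qed
  have F_eq: "F (2 * u) = u * (u\<^sup>2 * a) + (u - 1 / 8) * d + (1 / 2 - u / 2 - u\<^sup>2 / 4) * a' + (u\<^sup>2 * a) / 4"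
    by (simp add: F_def diff_divide_distrib add_divide_distrib right_diff_distrib left_diff_distrib
        distrib_left distrib_right)
  have A: "0 \<le> u\<^sup>2 * a" "0 \<le> u * (u\<^sup>2 * a)" using u nn by auto
  have F1: "0 \<le> F (2 * u)"
  \<comment> \<open>The cases follow the signs of the coefficients of \<open>d\<close> and
    \<open>a'\<close> in \<open>F_eq\<close>. A negative one is compensated by the hypothesis that
    bounds the quantity in question by the other one and \<open>a\<close>.\<close>
  proof (cases "u < 1 / 8")
    case True
    have "u\<^sup>2 \<le> (1 / 8)\<^sup>2" using True u by (intro power_mono) auto
    then have "0 \<le> (1 / 2 - u / 2 - u\<^sup>2 / 4 - 1 / 4) * a'"
      using True nn by (intro mult_nonneg_nonneg) (auto simp: power2_eq_square)
    moreover have "0 \<le> u * d" using u nn by simp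
    ultimately show ?thesis using d A unfolding F_eq by (simp add: algebra_simps)
  next
    case False
    then have ud: "0 \<le> (u - 1 / 8) * d" using nn by simp
    show ?thesis
    proof (cases "0 \<le> 1 / 2 - u / 2 - u\<^sup>2 / 4")
      case True
      then have "0 \<le> (1 / 2 - u / 2 - u\<^sup>2 / 4) * a'" using nn by simp
      then show ?thesis using ud A unfolding F_eq by linarith
    next
      case False
      then have "(1 / 2 - u / 2 - u\<^sup>2 / 4) * (2 * d + 2 * (u\<^sup>2 * a)) \<le> (1 / 2 - u / 2 - u\<^sup>2 / 4) * a'"
        using a' by (intro mult_left_mono_neg) auto
      moreover have "0 \<le> (1 - 1 / 8 - u\<^sup>2 / 2) * d" "0 \<le> (1 + 1 / 4 - u\<^sup>2 / 2) * (u\<^sup>2 * a)"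
        using usq nn A by (auto intro!: mult_nonneg_nonneg)
      ultimately show ?thesis unfolding F_eq by (simp add: algebra_simps)
    qed
  qed
  \<comment> \<open>The claim is affine in \<open>c\<close>, so the two end points suffice.\<close>
  have "F c = (1 - s) * F 0 + s * F (2 * u)"
    unfolding F_def s(3) by (simp add: field_simps)
  then have "0 \<le> F c" using F0 F1 s by simp
  then show ?thesis by (simp add: F_def)
qed

text \<open>The term \<open>T * B\<close> pays for the gradient difference up to an eighth of the
  squared norm of \<open>z2 - z1\<close>; the remaining terms are governed by the scalar
  inequality.\<close>

lemma remainder_ge:
  fixes y0 y1 z1 z2 v0 v1 :: "'a::real_inner"
  assumes y1: "y1 = (1 - b) *\<^sub>R y0 + b *\<^sub>R z1" and b: "0 < b" "b < 1"
    and e: "0 < e1" "0 < e2" "e2 \<le> 2 * (1 - b)\<^sup>2 * e1"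
    and B: "2 * e2 * (norm (v1 - v0))\<^sup>2 \<le> T * B"
  shows "(1 - b)\<^sup>2 / 4 * (norm (z2 - y1))\<^sup>2 - (1 - b)\<^sup>2 / 4 * (norm (z1 - y0))\<^sup>2
    \<le> e2 * (T * B + (v1 - v0) \<bullet> (z2 - z1))
      + e2 / e1 * ((y0 - z1) \<bullet> (z2 - z1)) + (1 - b / 2) * (norm (z2 - y1))\<^sup>2"
proof -
  \<comment> \<open>The coefficient of the cross term once \<open>y0 - z1\<close> is replaced by
    \<open>(y1 - z1) / (1 - b)\<close>. The bound on \<open>e2\<close> then reads
    \<open>c \<le> 2 * (1 - b)\<close>.\<close>
  define c where "c = e2 / (e1 * (1 - b))"
  have c: "0 \<le> c" "c \<le> 2 * (1 - b)"
    using e b by (auto simp: c_def divide_simps power2_eq_square mult_ac)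
  have yz: "y1 - z1 = (1 - b) *\<^sub>R (y0 - z1)" by (simp add: y1 algebra_simps)
  have zy: "(norm (z1 - y1))\<^sup>2 = (1 - b)\<^sup>2 * (norm (z1 - y0))\<^sup>2"
    unfolding norm_minus_commute[of z1 y1] norm_minus_commute[of z1 y0] yz
    by (simp add: power_mult_distrib)
  have "e2 / e1 * ((y0 - z1) \<bullet> (z2 - z1)) = c * ((y1 - z1) \<bullet> (z2 - z1))"
    using b e by (simp add: yz c_def)
  then have cross: "e2 / e1 * ((y0 - z1) \<bullet> (z2 - z1)) =
      c / 2 * ((1 - b)\<^sup>2 * (norm (z1 - y0))\<^sup>2 + (norm (z2 - z1))\<^sup>2 - (norm (z2 - y1))\<^sup>2)"
    unfolding inner_three_points[of y1] zy by simp
  have "(1 - b)\<^sup>2 / 4 * ((norm (z2 - y1))\<^sup>2 - (norm (z1 - y0))\<^sup>2)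
      \<le> c / 2 * ((1 - b)\<^sup>2 * (norm (z1 - y0))\<^sup>2 + (norm (z2 - z1))\<^sup>2 - (norm (z2 - y1))\<^sup>2)
        + (1 + (1 - b)) / 2 * (norm (z2 - y1))\<^sup>2 - (norm (z2 - z1))\<^sup>2 / 8"
    using b c norm_diff_sq_le[of z2 z1 y1] norm_diff_sq_le[of z2 y1 z1] zy
    by (intro potential_increase_scalar) (auto simp: norm_minus_commute)
  moreover have "- ((norm (z2 - z1))\<^sup>2 / 8) \<le> e2 * (T * B + (v1 - v0) \<bullet> (z2 - z1))"
  proof -
    define G where "G = e2 * norm (v1 - v0)"
    \<comment> \<open>Completing the square: the factor 2 in the hypothesis on \<open>B\<close>
      matches the loss of one eighth.\<close>
    have "0 \<le> 2 * (G - norm (z2 - z1) / 4)\<^sup>2" by simp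
    then have "- ((norm (z2 - z1))\<^sup>2 / 8) \<le> 2 * G\<^sup>2 - G * norm (z2 - z1)"
      by (simp add: power2_eq_square algebra_simps)
    moreover have "2 * G\<^sup>2 \<le> e2 * (T * B)"
      using mult_left_mono[OF B, of e2] e by (simp add: G_def power2_eq_square mult_ac)
    moreover have "- (e2 * ((v1 - v0) \<bullet> (z2 - z1))) \<le> G * norm (z2 - z1)"
    proof -
      have "- ((v1 - v0) \<bullet> (z2 - z1)) \<le> norm (v1 - v0) * norm (z2 - z1)"
        using Cauchy_Schwarz_ineq2[of "v1 - v0" "z2 - z1"] by linarith
      then have "e2 * (- ((v1 - v0) \<bullet> (z2 - z1))) \<le> e2 * (norm (v1 - v0) * norm (z2 - z1))"
        using e by (intro mult_left_mono) auto
      then show ?thesis by (simp add: G_def mult_ac)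
    qed
    ultimately show ?thesis by (simp add: distrib_left)
  qed
  ultimately show ?thesis unfolding cross by (simp add: algebra_simps add_divide_distrib diff_divide_distrib)
qed

text \<open>The first iteration has no term \<open>T * B\<close>, since \<open>\<tau> 1 = 0\<close>,
  so the gradient difference is paid for by the Lipschitz-type bound \<open>l\<close>; this creates
  the second summand of the final constant. As \<open>\<beta> 1 = 0\<close>, the point
  \<open>y0\<close> also stands for \<open>y1\<close>.\<close>

lemma initial_remainder_ge:
  fixes y0 z1 z2 v0 v1 :: "'a::real_inner"
  assumes b: "0 < b" "b < 1"
    and e: "0 < e1" "0 < e2" "e2 \<le> (1 - b) * e1"
    and l: "norm (v1 - v0) \<le> l * norm (z1 - y0)" "0 \<le> l" "4 * e2 * l \<le> 1"
  shows "(1 - b)\<^sup>2 / 4 * (norm (z2 - y0))\<^sup>2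
      - (5 * e2 * l / 4 - e2 / (2 * e1)) * (norm (z1 - y0))\<^sup>2
    \<le> e2 * ((v1 - v0) \<bullet> (z2 - z1))
      + e2 / e1 * ((y0 - z1) \<bullet> (z2 - z1)) + (1 - b / 2) * (norm (z2 - y0))\<^sup>2"
proof -
  define c where "c = e2 / e1"
  define r where "r = norm (z1 - y0)"
  define s where "s = norm (z2 - y0)"
  have rs: "0 \<le> r" "0 \<le> s" by (auto simp: r_def s_def)
  have c: "0 \<le> c" "c \<le> 1 - b" using e by (auto simp: c_def divide_simps)
  have "norm (z2 - z1) \<le> r + s"
    using norm_triangle_ineq4[of "z2 - y0" "z1 - y0"] by (simp add: r_def s_def)
  then have "norm (v1 - v0) * norm (z2 - z1) \<le> (l * r) * (r + s)"
    using l rs by (intro mult_mono) (auto simp: r_def)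
  then have "- ((v1 - v0) \<bullet> (z2 - z1)) \<le> (l * r) * (r + s)"
    using Cauchy_Schwarz_ineq2[of "v1 - v0" "z2 - z1"] by linarith
  then have "- (e2 * ((v1 - v0) \<bullet> (z2 - z1))) \<le> e2 * ((l * r) * (r + s))"
    using e mult_left_mono[of "- ((v1 - v0) \<bullet> (z2 - z1))" "(l * r) * (r + s)" e2] by simp
  also have "\<dots> = e2 * l * (r * (r + s))" by simp
  also have "\<dots> \<le> e2 * l * (5 / 4 * r\<^sup>2 + s\<^sup>2)"
  proof (rule mult_left_mono)
    \<comment> \<open>Young's inequality \<open>r * s \<le> r\<^sup>2 / 4 + s\<^sup>2\<close> is the
      source of 5/4; the weight 1 on \<open>s\<^sup>2\<close> becomes 1/4 through
      \<open>4 * e2 * l \<le> 1\<close>.\<close>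
    have "0 \<le> (r / 2 - s)\<^sup>2" by simp
    then show "r * (r + s) \<le> 5 / 4 * r\<^sup>2 + s\<^sup>2" by (simp add: power2_eq_square algebra_simps)
  qed (use e l in auto)
  also have "\<dots> \<le> 5 * e2 * l / 4 * r\<^sup>2 + s\<^sup>2 / 4"
    using mult_right_mono[OF l(3), of "s\<^sup>2"] by (simp add: algebra_simps)
  finally have grad: "- (e2 * ((v1 - v0) \<bullet> (z2 - z1))) \<le> 5 * e2 * l / 4 * r\<^sup>2 + s\<^sup>2 / 4" .
  \<comment> \<open>The three-point identity with the square of \<open>norm (z2 - z1)\<close>
    discarded.\<close>
  have "c / 2 * (r\<^sup>2 - s\<^sup>2) \<le> c * ((y0 - z1) \<bullet> (z2 - z1))"
    unfolding inner_three_points using c by (simp add: r_def s_def mult_left_mono)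
  then have cross: "c / 2 * r\<^sup>2 - c / 2 * s\<^sup>2 \<le> c * ((y0 - z1) \<bullet> (z2 - z1))"
    by (simp add: right_diff_distrib)
  \<comment> \<open>Budget for \<open>s\<^sup>2\<close>: at most 1/4 for the potential, 1/4 for the
    gradient and \<open>(1 - b) / 2\<close> for the cross term, in total
    \<open>1 - b / 2\<close>.\<close>
  have "(1 - b)\<^sup>2 \<le> 1" using b by (simp add: power_le_one)
  then have "(1 - b)\<^sup>2 / 4 + 1 / 4 + c / 2 \<le> 1 - b / 2" using c by simp
  from mult_right_mono[OF this, of "s\<^sup>2"]
  have "(1 - b)\<^sup>2 / 4 * s\<^sup>2 + s\<^sup>2 / 4 + c / 2 * s\<^sup>2 \<le> (1 - b / 2) * s\<^sup>2"
    by (simp add: distrib_right)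
  moreover have "(5 * e2 * l / 4 - e2 / (2 * e1)) * r\<^sup>2 = 5 * e2 * l / 4 * r\<^sup>2 - c / 2 * r\<^sup>2"
    by (simp add: c_def left_diff_distrib)
  ultimately show ?thesis
    using grad cross unfolding c_def[symmetric] r_def[symmetric] s_def[symmetric] by linarith
qed

section \<open>Summation by parts and the step size rule\<close>

text \<open>Each \<open>D t\<close> with \<open>t < k\<close> collects a positive contribution from
  summand \<open>t\<close> and a negative one from summand \<open>t + 1\<close>;
  \<open>\<tau> 1 = 0\<close> removes \<open>D 0\<close>.\<close>

lemma weighted_telescope:
  fixes \<eta> \<tau> D :: "nat \<Rightarrow> real"
  assumes "\<tau> 1 = 0" "1 \<le> k"
  shows "(\<Sum>t = 1..k. \<eta> (t + 1) * ((1 + \<tau> t) * D t - \<tau> t * D (t - 1))) =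
    (\<Sum>t = 1..k - 1. ((\<tau> t + 1) * \<eta> (t + 1) - \<tau> (t + 1) * \<eta> (t + 2)) * D t)
      + ((\<tau> k + 1) * \<eta> (k + 1)) * D k"
  using assms(2)
proof (induction k rule: nat_induct_at_least)
  case base
  then show ?case using assms(1) by simp
next
  case (Suc n)
  then obtain m where "n = Suc m" by (cases n) auto
  then show ?case using Suc by (simp add: algebra_simps)
qed

text \<open>For \<open>c = 0\<close> the convention 0/0 = 0 and \<open>0 < e\<close> exclude
  \<open>a = 0\<close>; for \<open>c > 0\<close> positivity of \<open>a\<close> follows from
  \<open>e * c \<le> a\<close>.\<close>

lemma ereal_le_divideD:
  assumes "ereal e \<le> ereal a / ereal c" "0 < e" "0 \<le> a" "0 \<le> c"
  shows "0 < a" and "e * c \<le> a"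
proof -
  have "0 < a \<and> e * c \<le> a"
  proof (cases "c = 0")
    case True
    then have "a \<noteq> 0" using assms ereal_zero_divide_zero by auto
    then show ?thesis using True assms by simp
  next
    case False
    then have "e * c \<le> a" "0 < e * c" using assms by (auto simp: field_simps)
    then show ?thesis by simp
  qed
  then show "0 < a" "e * c \<le> a" by auto
qed

text \<open>Division-free form of the step size rule. The bound through the local estimate becomes
  the hypothesis on \<open>T * B\<close> in \<open>remainder_ge\<close>.\<close>

lemma adaptive_step_size_bounds:
  fixes \<eta> \<tau> :: "nat \<Rightarrow> real"
  assumes smooth: "smooth_oracle X f g" and x: "x t \<in> X" "x (t - 1) \<in> X" and t: "2 \<le> t"
    and pos: "\<And>t. 1 \<le> t \<Longrightarrow> 0 < \<eta> t" "\<And>t. 1 \<le> t \<Longrightarrow> 0 \<le> \<tau> t"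
    and bound: "ereal (\<eta> (t + 1)) \<le> Min {ereal (2 * (1 - b)\<^sup>2 * \<eta> t),
        ereal (\<tau> t) / ereal (4 * local_estimate f g x t),
        ereal (\<tau> (t - 1) + 1) / ereal (\<tau> t) * ereal (\<eta> t)}"
  shows "\<eta> (t + 1) \<le> 2 * (1 - b)\<^sup>2 * \<eta> t"
    and "2 * \<eta> (t + 1) * (norm (g (x t) - g (x (t - 1))))\<^sup>2
      \<le> \<tau> t * (f (x (t - 1)) - f (x t) - g (x t) \<bullet> (x (t - 1) - x t))"
    and "\<tau> t * \<eta> (t + 1) \<le> (\<tau> (t - 1) + 1) * \<eta> t"
proof -
  define B where "B = f (x (t - 1)) - f (x t) - g (x t) \<bullet> (x (t - 1) - x t)"
  define G where "G = (norm (g (x t) - g (x (t - 1))))\<^sup>2"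
  define l where "l = local_estimate f g x t"
  have l: "l = (if B = 0 then 0 else G / (2 * B))"
    using t by (simp add: l_def local_estimate_def B_def G_def Let_def)
  have bounds: "ereal (\<eta> (t + 1)) \<le> ereal (2 * (1 - b)\<^sup>2 * \<eta> t)"
      "ereal (\<eta> (t + 1)) \<le> ereal (\<tau> t) / ereal (4 * l)"
      "ereal (\<eta> (t + 1)) \<le> ereal (\<tau> (t - 1) + 1) / ereal (\<tau> t) * ereal (\<eta> t)"
    using bound by (auto simp: l_def)
  show "\<eta> (t + 1) \<le> 2 * (1 - b)\<^sup>2 * \<eta> t" using bounds(1) by simp
  obtain K where K: "0 < K" "1 / (2 * K) * G \<le> B"
    using smooth x unfolding smooth_oracle_def G_def B_def by (metis norm_minus_commute)
  have G: "0 \<le> G" by (simp add: G_def)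
  have B: "0 \<le> B" using order_trans[OF _ K(2), of 0] K(1) G by simp
  have "0 \<le> 4 * l" using G B by (simp add: l)
  \<comment> \<open>Even for \<open>l = 0\<close> this gives \<open>\<tau> t > 0\<close>, so the
    quotient in the third bound is an ordinary real one.\<close>
  note tau = ereal_le_divideD[OF bounds(2) pos(1) pos(2) this]
  have tau_pos: "0 < \<tau> t" and tau_l: "\<eta> (t + 1) * (4 * l) \<le> \<tau> t" using tau t by auto
  have "2 * \<eta> (t + 1) * G \<le> \<tau> t * B"
  proof (cases "B = 0")
    case True
    \<comment> \<open>Smoothness makes the gradients agree when \<open>B = 0\<close>, which
      justifies the value 0 of the local estimate.\<close>
    then have "G \<le> 0" using K by (simp add: field_simps)
    then show ?thesis using True G by simp
  next
    case False
    then show ?thesis using mult_right_mono[OF tau_l B] by (simp add: l field_simps)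
  qed
  then show "2 * \<eta> (t + 1) * (norm (g (x t) - g (x (t - 1))))\<^sup>2
      \<le> \<tau> t * (f (x (t - 1)) - f (x t) - g (x t) \<bullet> (x (t - 1) - x t))"
    by (simp add: G_def B_def)
  show "\<tau> t * \<eta> (t + 1) \<le> (\<tau> (t - 1) + 1) * \<eta> t"
    using bounds(3) tau_pos by (simp add: field_simps)
qed

section \<open>Transfer of boundedness between the sequences\<close>

text \<open>For \<open>t \<ge> 2\<close> the averaging rule can be solved for \<open>z t\<close>
  because \<open>b > 0\<close>; the indices 0 and 1 are covered by the maximum.\<close>

lemma bounded_range_of_averages:
  fixes y z :: "nat \<Rightarrow> 'a::real_normed_vector"
  assumes b: "0 < b" "b < 1" and y: "bounded (range y)"
    and step: "\<And>t. 2 \<le> t \<Longrightarrow> y t = (1 - b) *\<^sub>R y (t - 1) + b *\<^sub>R z t"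
  shows "bounded (range z)"
proof -
  obtain C where C: "\<And>t. norm (y t) \<le> C" using y by (auto simp: bounded_iff)
  have "norm (z t) \<le> max (2 * C / b) (max (norm (z 0)) (norm (z 1)))" for t
  proof (cases "2 \<le> t")
    case True
    have "b *\<^sub>R z t = y t - (1 - b) *\<^sub>R y (t - 1)" using step[OF True] by simp
    then have "b * norm (z t) = norm (y t - (1 - b) *\<^sub>R y (t - 1))"
      using b by (metis abs_of_pos norm_scaleR)
    also have "\<dots> \<le> norm (y t) + (1 - b) * norm (y (t - 1))"
      using norm_triangle_ineq4[of "y t" "(1 - b) *\<^sub>R y (t - 1)"] b by simp
    also have "\<dots> \<le> C + 1 * C"
      using b C[of t] C[of "t - 1"] by (intro add_mono mult_mono) auto
    finally have "norm (z t) \<le> 2 * C / b" using b by (simp add: field_simps)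
    then show ?thesis by simp
  next
    case False
    then have "t = 0 \<or> t = 1" by auto
    then show ?thesis by auto
  qed
  then show ?thesis by (auto simp: bounded_iff)
qed

text \<open>Each \<open>x t\<close> is a convex combination of \<open>z t\<close> and
  \<open>x (t - 1)\<close>, so a bound for all \<open>z t\<close> passes to \<open>x\<close> by
  induction.\<close>

lemma bounded_range_of_extrapolations:
  fixes x z :: "nat \<Rightarrow> 'a::real_normed_vector"
  assumes z: "bounded (range z)" and x0: "x 0 = z 0"
    and tau: "\<And>t. 1 \<le> t \<Longrightarrow> (0::real) \<le> \<tau> t"
    and step: "\<And>t. 1 \<le> t \<Longrightarrow> (1 + \<tau> t) *\<^sub>R x t = z t + \<tau> t *\<^sub>R x (t - 1)"
  shows "bounded (range x)"
proof -
  obtain C where C: "\<And>t. norm (z t) \<le> C" using z by (auto simp: bounded_iff)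
  have "norm (x t) \<le> C" for t
  proof (induction t)
    case 0
    then show ?case using C x0 by simp
  next
    case (Suc t)
    have "(1 + \<tau> (Suc t)) * norm (x (Suc t)) = norm (z (Suc t) + \<tau> (Suc t) *\<^sub>R x t)"
      using step[of "Suc t"] tau[of "Suc t"] by (metis abs_of_nonneg add_nonneg_nonneg
          diff_Suc_1 le_add1 norm_scaleR plus_1_eq_Suc zero_le_one)
    also have "\<dots> \<le> norm (z (Suc t)) + \<tau> (Suc t) * norm (x t)"
      using norm_triangle_ineq[of "z (Suc t)" "\<tau> (Suc t) *\<^sub>R x t"] tau[of "Suc t"] by simp
    also have "\<dots> \<le> C + \<tau> (Suc t) * C"
      using C[of "Suc t"] Suc tau[of "Suc t"] by (intro add_mono mult_left_mono) auto
    also have "\<dots> = (1 + \<tau> (Suc t)) * C" by (simp add: algebra_simps)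
    finally show ?case using tau[of "Suc t"] by (simp add: mult_le_cancel_left)
  qed
  then show ?thesis by (auto simp: bounded_iff)
qed

section \<open>Jensen's inequality for the averaged iterate\<close>

text \<open>The average is a true convex combination: \<open>mono\<close> makes the weights
  nonnegative, and summation by parts computes their sum.\<close>

lemma averaged_iterate_le:
  fixes x :: "nat \<Rightarrow> real ^ 'n"
  assumes \<Psi>: "convex_on X \<Psi>" and x: "\<And>t. x t \<in> X" and k: "1 \<le> k" and \<tau>1: "\<tau> 1 = 0"
    and pos: "\<And>t. 1 \<le> t \<Longrightarrow> 0 < \<eta> t" "\<And>t. 1 \<le> t \<Longrightarrow> 0 \<le> \<tau> t"
    and mono: "\<And>t. 2 \<le> t \<Longrightarrow> \<tau> t * \<eta> (t + 1) \<le> (\<tau> (t - 1) + 1) * \<eta> t"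
  shows "(\<Sum>t = 2..k + 1. \<eta> t) * (\<Psi> (averaged_iterate \<eta> \<tau> x k) - c)
    \<le> (\<Sum>t = 1..k. \<eta> (t + 1) * ((1 + \<tau> t) * (\<Psi> (x t) - c) - \<tau> t * (\<Psi> (x (t - 1)) - c)))"
proof -
  define S where "S = (\<Sum>t = 2..k + 1. \<eta> t)"
  have S: "0 < S" unfolding S_def using pos k by (intro sum_pos) auto
  \<comment> \<open>At \<open>t = k\<close> nothing is subtracted, since there is no summand
    \<open>k + 1\<close>.\<close>
  define w where "w t = (if t < k then (\<tau> t + 1) * \<eta> (t + 1) - \<tau> (t + 1) * \<eta> (t + 2)
      else (\<tau> k + 1) * \<eta> (k + 1))" for t
  have w: "0 \<le> w t" if "1 \<le> t" for t
    using mono[of "t + 1"] pos(1)[of "k + 1"] pos(2)[of k] k that by (auto simp: w_def)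
  obtain m where m: "k = Suc m" using k by (cases k) auto
  have split_last: "(\<Sum>t = 1..k. w t * D t) =
      (\<Sum>t = 1..k. \<eta> (t + 1) * ((1 + \<tau> t) * D t - \<tau> t * D (t - 1)))" for D
    unfolding weighted_telescope[of \<tau>, OF \<tau>1 k] by (simp add: m w_def)
  \<comment> \<open>For constant \<open>D = 1\<close> each summand on the right of
    \<open>split_last\<close> reduces to \<open>\<eta> (t + 1)\<close>.\<close>
  have w_sum: "(\<Sum>t = 1..k. w t) = S"
    using split_last[of "\<lambda>_. 1"] sum.shift_bounds_cl_Suc_ivl[of \<eta> 1 k]
    by (simp add: S_def numeral_2_eq_2)
  have avg: "averaged_iterate \<eta> \<tau> x k = (\<Sum>t = 1..k. (w t / S) *\<^sub>R x t)"
  proof -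
    have "averaged_iterate \<eta> \<tau> x k = (\<Sum>t = 1..k. w t *\<^sub>R x t) /\<^sub>R S"
      unfolding averaged_iterate_def S_def[symmetric] by (simp add: m w_def)
    then show ?thesis by (simp add: scaleR_sum_right divide_inverse_commute)
  qed
  have "\<Psi> (averaged_iterate \<eta> \<tau> x k) \<le> (\<Sum>t = 1..k. w t / S * \<Psi> (x t))"
    unfolding avg
  proof (rule convex_on_sum[OF _ _ \<Psi>])
    show "(\<Sum>t = 1..k. w t / S) = 1"
      using w_sum S by (simp flip: sum_divide_distrib)
  qed (use k w S x in auto)
  also have "\<dots> = (\<Sum>t = 1..k. w t * \<Psi> (x t)) / S" by (simp add: sum_divide_distrib)
  finally have "S * \<Psi> (averaged_iterate \<eta> \<tau> x k) \<le> (\<Sum>t = 1..k. w t * \<Psi> (x t))"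
    using S by (simp add: field_simps)
  moreover have "(\<Sum>t = 1..k. w t * (\<Psi> (x t) - c)) = (\<Sum>t = 1..k. w t * \<Psi> (x t)) - S * c"
    by (simp only: right_diff_distrib sum_subtractf sum_distrib_right[symmetric] w_sum)
  ultimately show ?thesis
    unfolding split_last[of "\<lambda>t. \<Psi> (x t) - c", symmetric] S_def[symmetric]
    by (simp add: right_diff_distrib)
qed

section \<open>Energy estimate, boundedness and convergence rates\<close>

theorem theorem1:
  fixes X :: "(real ^ 'n) set"
    and f h \<Psi> :: "real ^ 'n \<Rightarrow> real"
    and g :: "real ^ 'n \<Rightarrow> real ^ 'n"
    and x y z :: "nat \<Rightarrow> real ^ 'n"
    and \<eta> \<tau> \<beta> L :: "nat \<Rightarrow> real"
    and b :: real
  defines "\<Psi> \<equiv> \<lambda>u. f u + h u"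
    and "L \<equiv> local_estimate f g x"
  assumes "X \<noteq> {}" and "closed X" and "convex X"
    and "closed_convex_fun X f" and "closed_convex_fun X h"
    and "minimizers X \<Psi> \<noteq> {}"
    and "smooth_oracle X f g"
    and "ac_fgm X h g \<eta> \<tau> \<beta> z y x"
    and "\<And>t. t \<ge> 1 \<Longrightarrow> \<eta> t > 0"
    and "\<And>t. t \<ge> 1 \<Longrightarrow> \<tau> t \<ge> 0"
    and "x 1 \<noteq> x 0"
    and "0 < b" and "b < 1"
    and "\<tau> 1 = 0" and "\<beta> 1 = 0" and "\<And>t. t \<ge> 2 \<Longrightarrow> \<beta> t = b"
    and "ereal (\<eta> 2) \<le> min (ereal ((1 - b) * \<eta> 1)) (ereal 1 / ereal (4 * L 1))"
    and "\<And>t. t \<ge> 3 \<Longrightarrow>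
           ereal (\<eta> t) \<le> Min {ereal (2 * (1 - b)\<^sup>2 * \<eta> (t - 1)),
                             ereal (\<tau> (t - 1)) / ereal (4 * L (t - 1)),
                             ereal (\<tau> (t - 2) + 1) / ereal (\<tau> (t - 1)) * ereal (\<eta> (t - 1))}"
  shows "bounded (range z) \<and> bounded (range y) \<and> bounded (range x) \<and>
    (\<forall>xs \<in> minimizers X \<Psi>. \<forall>k\<ge>1.
       \<Psi> (x k) - \<Psi> xs \<le> 1 / ((\<tau> k + 1) * \<eta> (k + 1)) *
         (1 / (2 * b) * (norm (z 0 - xs))\<^sup>2
            + (5 * \<eta> 2 * L 1 / 4 - \<eta> 2 / (2 * \<eta> 1)) * (norm (z 1 - z 0))\<^sup>2) \<and>
       \<Psi> (averaged_iterate \<eta> \<tau> x k) - \<Psi> xs \<le> 1 / (\<Sum>t = 2..k + 1. \<eta> t) *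
         (1 / (2 * b) * (norm (z 0 - xs))\<^sup>2
            + (5 * \<eta> 2 * L 1 / 4 - \<eta> 2 / (2 * \<eta> 1)) * (norm (z 1 - z 0))\<^sup>2))"
proof -
  have h: "convex_on X h" and f: "convex_on X f"
    using assms(6,7) by (auto simp: closed_convex_fun_def)
  have \<Psi>: "convex_on X \<Psi>" unfolding \<Psi>_def using f h by (rule convex_on_add)
  have b: "0 < b" "b < 1" by fact+
  note \<eta> = assms(11) and \<tau> = assms(12)
  have start: "x 0 \<in> X" "y 0 = z 0" "x 0 = z 0"
    using assms(10) by (auto simp: ac_fgm_def)
  have z_step: "is_arg_min (\<lambda>u. \<eta> t * (g (x (t - 1)) \<bullet> u + h u) + 1 / 2 * (norm (y (t - 1) - u))\<^sup>2)
        (\<lambda>u. u \<in> X) (z t)"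
    and y_step: "y t = (1 - \<beta> t) *\<^sub>R y (t - 1) + \<beta> t *\<^sub>R z t"
    and x_step: "x t = (z t + \<tau> t *\<^sub>R x (t - 1)) /\<^sub>R (1 + \<tau> t)" if "1 \<le> t" for t
    using assms(10) that unfolding ac_fgm_def by blast+
  have y1: "y 1 = z 0" using y_step[of 1] assms(17) start by simp
  have x1: "x 1 = z 1" using x_step[of 1] assms(16) by simp
  have x_scaled: "(1 + \<tau> t) *\<^sub>R x t = z t + \<tau> t *\<^sub>R x (t - 1)" if "1 \<le> t" for t
    using x_step[OF that] \<tau>[OF that] by simp
  have xX: "x t \<in> X" for t
  proof (induction t)
    case (Suc t)
    define r where "r = inverse (1 + \<tau> (Suc t))"
    have r: "r + r * \<tau> (Suc t) = 1" "0 \<le> r" "0 \<le> r * \<tau> (Suc t)"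
      using \<tau>[of "Suc t"] by (auto simp: r_def field_simps)
    have "x (Suc t) = r *\<^sub>R z (Suc t) + (r * \<tau> (Suc t)) *\<^sub>R x t"
      using x_step[of "Suc t"] by (simp add: r_def scaleR_add_right)
    moreover have "z (Suc t) \<in> X" using z_step[of "Suc t"] by (simp add: is_arg_min_def)
    ultimately show ?case using convexD[OF assms(5) _ Suc r(2,3,1)] by simp
  qed (use start in simp)
  have sub: "g (x t) \<in> subdifferential X f (x t)" for t
    using assms(9) xX by (simp add: smooth_oracle_def)
  \<comment> \<open>By \<open>x1\<close> and \<open>start\<close> the denominator of
    \<open>L 1\<close> is the norm of \<open>z 1 - z 0\<close>, which is nonzero because
    \<open>x 1 \<noteq> x 0\<close>.\<close>
  have L1: "0 \<le> L 1" "norm (g (x 1) - g (x 0)) = L 1 * norm (z 1 - z 0)"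
    using assms(13) unfolding L_def local_estimate_def x1 start by simp_all
  have "ereal (\<eta> 2) \<le> ereal 1 / ereal (4 * L 1)" using assms(19) by simp
  from ereal_le_divideD(2)[OF this] have \<eta>2_L: "4 * \<eta> 2 * L 1 \<le> 1"
    using \<eta>[of 2] L1 by (simp add: mult_ac)
  have \<eta>2: "\<eta> 2 \<le> (1 - b) * \<eta> 1" using assms(19) by simp
  \<comment> \<open>The rule for indices from 3 on, shifted so that \<open>t \<ge> 2\<close> is the
    iteration analysed.\<close>
  have "ereal (\<eta> (t + 1)) \<le> Min {ereal (2 * (1 - b)\<^sup>2 * \<eta> t),
        ereal (\<tau> t) / ereal (4 * local_estimate f g x t),
        ereal (\<tau> (t - 1) + 1) / ereal (\<tau> t) * ereal (\<eta> t)}" if "2 \<le> t" for t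
  proof -
    have idx: "3 \<le> t + 1" "t + 1 - 1 = t" "t + 1 - 2 = t - 1" using that by auto
    show ?thesis using assms(20)[OF idx(1)] unfolding idx(2,3) L_def .
  qed
  note size = adaptive_step_size_bounds[OF assms(9) xX xX _ \<eta> \<tau> this]

  define p where "p = (1 - b)\<^sup>2 / 4"
  define C where "C u = 1 / (2 * b) * (norm (z 0 - u))\<^sup>2
      + (5 * \<eta> 2 * L 1 / 4 - \<eta> 2 / (2 * \<eta> 1)) * (norm (z 1 - z 0))\<^sup>2" for u
  define gap where "gap u t = \<eta> (t + 1) *
      ((1 + \<tau> t) * (\<Psi> (x t) - \<Psi> u) - \<tau> t * (\<Psi> (x (t - 1)) - \<Psi> u))" for u t
  have step: "gap u t + (\<eta> (t + 1) * (\<tau> t * (f (x (t - 1)) - f (x t) - g (x t) \<bullet> (x (t - 1) - x t))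
          + (g (x t) - g (x (t - 1))) \<bullet> (z (t + 1) - z t))
        + \<eta> (t + 1) / \<eta> t * ((y (t - 1) - z t) \<bullet> (z (t + 1) - z t))
        + (1 - b / 2) * (norm (z (t + 1) - y t))\<^sup>2)
      \<le> 1 / (2 * b) * ((norm (y t - u))\<^sup>2 - (norm (y (t + 1) - u))\<^sup>2)"
    if "1 \<le> t" "u \<in> X" for t u
  proof -
    have *: "gap u t = \<eta> (t + 1) * ((1 + \<tau> t) * (f (x t) + h (x t))
        - \<tau> t * (f (x (t - 1)) + h (x (t - 1))) - (f u + h u))"
      unfolding gap_def \<Psi>_def by (simp add: algebra_simps)
    have z2: "is_arg_min (\<lambda>u. \<eta> (t + 1) * (g (x t) \<bullet> u + h u) + 1 / 2 * (norm (y t - u))\<^sup>2)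
        (\<lambda>u. u \<in> X) (z (t + 1))" using z_step[of "t + 1"] by simp
    have y2: "y (t + 1) = (1 - b) *\<^sub>R y t + b *\<^sub>R z (t + 1)"
      using y_step[of "t + 1"] assms(18)[of "t + 1"] that by simp
    show ?thesis
      using ac_fgm_step[OF h sub z_step[OF that(1)] z2 x_step[OF that(1)] y2
          \<eta>[OF that(1)] \<eta> \<tau>[OF that(1)] b(1) xX that(2)]
      unfolding * by (simp add: add.assoc)
  qed
  \<comment> \<open>Holds for every \<open>u\<close> in \<open>X\<close>, whatever the signs of the
    gaps. The base case produces the constant \<open>C u\<close>; in the induction step the
    remainder dominates the change of the potential.\<close>
  have energy: "(\<Sum>t = 1..k. gap u t) + p * (norm (z (k + 1) - y k))\<^sup>2
      + 1 / (2 * b) * (norm (y (k + 1) - u))\<^sup>2 \<le> C u" if "1 \<le> k" "u \<in> X" for k u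
    using that(1)
  proof (induction k rule: nat_induct_at_least)
    case base
    have "norm (g (x 1) - g (x 0)) \<le> L 1 * norm (z 1 - z 0)" using L1 by simp
    from initial_remainder_ge[OF b \<eta>[of 1] \<eta>[of 2] \<eta>2 this L1(1) \<eta>2_L, of "z 2"]
    show ?case
      using step[of 1 u] that(2) assms(16) start y1
      by (simp add: C_def p_def right_diff_distrib numeral_2_eq_2)
  next
    case (Suc n)
    then have n: "2 \<le> Suc n" "1 \<le> Suc n" by auto
    have y_n: "y (Suc n) = (1 - b) *\<^sub>R y n + b *\<^sub>R z (Suc n)"
      using y_step[OF n(2)] assms(18)[OF n(1)] by simp
    have "\<eta> (Suc n + 1) \<le> 2 * (1 - b)\<^sup>2 * \<eta> (Suc n)" using size(1)[OF n(1)] n by simp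
    moreover have "2 * \<eta> (Suc n + 1) * (norm (g (x (Suc n)) - g (x n)))\<^sup>2
        \<le> \<tau> (Suc n) * (f (x n) - f (x (Suc n)) - g (x (Suc n)) \<bullet> (x n - x (Suc n)))"
      using size(2)[OF n(1)] n by simp
    ultimately have "p * (norm (z (Suc n + 1) - y (Suc n)))\<^sup>2 - p * (norm (z (Suc n) - y n))\<^sup>2
      \<le> \<eta> (Suc n + 1) * (\<tau> (Suc n) * (f (x n) - f (x (Suc n)) - g (x (Suc n)) \<bullet> (x n - x (Suc n)))
          + (g (x (Suc n)) - g (x n)) \<bullet> (z (Suc n + 1) - z (Suc n)))
        + \<eta> (Suc n + 1) / \<eta> (Suc n) * ((y n - z (Suc n)) \<bullet> (z (Suc n + 1) - z (Suc n)))
        + (1 - b / 2) * (norm (z (Suc n + 1) - y (Suc n)))\<^sup>2"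
      unfolding p_def using n by (intro remainder_ge[OF y_n b \<eta> \<eta>]) auto
    then show ?case using step[OF n(2) that(2)] Suc.IH
      by (simp add: right_diff_distrib)
  qed
  have gap_bound: "(\<Sum>t = 1..k. gap u t) \<le> C u" if "1 \<le> k" "u \<in> X" for k u
  proof -
    have "0 \<le> p * (norm (z (k + 1) - y k))\<^sup>2" "0 \<le> 1 / (2 * b) * (norm (y (k + 1) - u))\<^sup>2"
      using b by (auto simp: p_def)
    then show ?thesis using energy[OF that] by linarith
  qed
  \<comment> \<open>At a minimizer all gaps of values are nonnegative, and so are their weights by
    \<open>size(3)\<close>; hence only the last term is kept.\<close>
  have tail: "((\<tau> k + 1) * \<eta> (k + 1)) * (\<Psi> (x k) - \<Psi> xs) \<le> (\<Sum>t = 1..k. gap xs t)"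
    if "xs \<in> minimizers X \<Psi>" "1 \<le> k" for k xs
  proof -
    have "0 \<le> ((\<tau> t + 1) * \<eta> (t + 1) - \<tau> (t + 1) * \<eta> (t + 2)) * (\<Psi> (x t) - \<Psi> xs)"
      if "t \<in> {1..k - 1}" for t
      using size(3)[of "t + 1"] that \<open>xs \<in> minimizers X \<Psi>\<close> xX[of t]
      by (intro mult_nonneg_nonneg) (auto simp: minimizers_def is_arg_min_linorder)
    then have "0 \<le> (\<Sum>t = 1..k - 1.
        ((\<tau> t + 1) * \<eta> (t + 1) - \<tau> (t + 1) * \<eta> (t + 2)) * (\<Psi> (x t) - \<Psi> xs))"
      by (rule sum_nonneg)
    then show ?thesis
      unfolding gap_def weighted_telescope[of \<tau>, OF assms(16) that(2), of \<eta> "\<lambda>t. \<Psi> (x t) - \<Psi> xs"]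
      by simp
  qed

  have bounded_y: "bounded (range y)"
  proof -
    obtain xs where xs: "xs \<in> minimizers X \<Psi>" using assms(8) by auto
    then have xsX: "xs \<in> X" by (auto simp: minimizers_def is_arg_min_def)
    \<comment> \<open>By \<open>tail\<close> the gap sum at a minimizer is nonnegative, so
      \<open>energy\<close> bounds the leftover distance. This covers the indices from 2 on;
      \<open>y 0\<close> and \<open>y 1\<close> both equal \<open>z 0\<close>.\<close>
    have "1 / (2 * b) * (norm (y (Suc (Suc m)) - xs))\<^sup>2 \<le> C xs" for m
    proof -
      have "0 \<le> ((\<tau> (Suc m) + 1) * \<eta> (Suc m + 1)) * (\<Psi> (x (Suc m)) - \<Psi> xs)"
        using xs xX[of "Suc m"] \<eta>[of "Suc m + 1"] \<tau>[of "Suc m"]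
        by (intro mult_nonneg_nonneg) (auto simp: minimizers_def is_arg_min_linorder)
      then have "0 \<le> (\<Sum>t = 1..Suc m. gap xs t)" using tail[OF xs, of "Suc m"] by simp
      moreover have "0 \<le> p * (norm (z (Suc m + 1) - y (Suc m)))\<^sup>2" by (simp add: p_def)
      ultimately show ?thesis using energy[OF _ xsX, of "Suc m"] by simp
    qed
    then have "(norm (y (Suc (Suc m)) - xs))\<^sup>2 \<le> 2 * b * C xs" for m
      using b by (simp add: field_simps)
    then have y_SS: "norm (y (Suc (Suc m)) - xs) \<le> sqrt (2 * b * C xs)" for m
      using real_le_rsqrt by blast
    have "norm (y t - xs) \<le> max (norm (z 0 - xs)) (sqrt (2 * b * C xs))" for t
    proof (cases "2 \<le> t")
      case True
      then obtain m where "t = Suc (Suc m)" by (metis add_2_eq_Suc le_Suc_ex)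
      then show ?thesis using y_SS[of m] by simp
    next
      case False
      then have "t = 0 \<or> t = 1" by auto
      then show ?thesis using start y1 by auto
    qed
    then show ?thesis
      unfolding bounded_def by (auto simp: dist_norm norm_minus_commute intro!: exI[of _ xs])
  qed
  have bounded_z: "bounded (range z)"
    using y_step assms(18) by (intro bounded_range_of_averages[OF b bounded_y]) auto
  have bounded_x: "bounded (range x)"
    using bounded_range_of_extrapolations[OF bounded_z start(3) \<tau> x_scaled] .
  have "\<Psi> (x k) - \<Psi> xs \<le> 1 / ((\<tau> k + 1) * \<eta> (k + 1)) * C xs \<and>
      \<Psi> (averaged_iterate \<eta> \<tau> x k) - \<Psi> xs \<le> 1 / (\<Sum>t = 2..k + 1. \<eta> t) * C xs"
    if xs: "xs \<in> minimizers X \<Psi>" and k: "1 \<le> k" for xs k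
  proof
    have xsX: "xs \<in> X" using xs by (auto simp: minimizers_def is_arg_min_def)
    have "((\<tau> k + 1) * \<eta> (k + 1)) * (\<Psi> (x k) - \<Psi> xs) \<le> C xs"
      using tail[OF xs k] gap_bound[OF k xsX] by linarith
    moreover have "0 < (\<tau> k + 1) * \<eta> (k + 1)"
      using \<eta>[of "k + 1"] \<tau>[OF k] by (intro mult_pos_pos) auto
    ultimately show "\<Psi> (x k) - \<Psi> xs \<le> 1 / ((\<tau> k + 1) * \<eta> (k + 1)) * C xs"
      by (simp add: pos_le_divide_eq mult.commute)
    have "0 < (\<Sum>t = 2..k + 1. \<eta> t)" using \<eta> k by (intro sum_pos) auto
    \<comment> \<open>Here Jensen's inequality replaces \<open>tail\<close>: the whole gap sum is
      used rather than its last term.\<close>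
    moreover have "(\<Sum>t = 2..k + 1. \<eta> t) * (\<Psi> (averaged_iterate \<eta> \<tau> x k) - \<Psi> xs) \<le> C xs"
      using averaged_iterate_le[where x = x and c = "\<Psi> xs", OF \<Psi> _ k assms(16) \<eta> \<tau> size(3)]
        gap_bound[OF k xsX] xX unfolding gap_def by (meson order_trans)
    ultimately show "\<Psi> (averaged_iterate \<eta> \<tau> x k) - \<Psi> xs \<le> 1 / (\<Sum>t = 2..k + 1. \<eta> t) * C xs"
      by (simp add: pos_le_divide_eq mult.commute)
  qed
  then show ?thesis using bounded_x bounded_y bounded_z unfolding C_def by blast
qed

end
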